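(* Let $[P]$ be a convex quadratic program with objective $f(x):=x^\top Hx+c^\top x$ (to be minimized), where $H\in\mathbb{Q}^{n\times n}$ is a positive definite matrix and $c\in\mathbb{Q}^n$, and with feasible set $\mathcal{X}:=\{x\in\mathbb{R}^n : Ax\ge b\}$, where $A\in\mathbb{Q}^{m\times n}$ and $b\in\mathbb{Q}^m$. Let $\overline{x}\in\mathbb{Q}^n$ be an optimal solution of $[P]$. Suppose there is a point $\tilde{x}\in\mathbb{Q}^n$ that is $\epsilon$-feasible for $[P]$. Then $$f(\tilde{x})\ge f(\overline{x})-\|\overline{\lambda}\|_1\,\epsilon,$$ where $\overline{\lambda}$ is an optimal solution to the dual of $[P]$. Moreover, $\|\overline{\lambda}\|_1$ can be bounded by a constant $g(A,b,H,c)$ whose bit-length is polynomial in the bit-complexity of the input $(A,b,H,c)$.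
   Context: A point $\tilde{x}$ is $\epsilon$-feasible for $[P]$ if $A\tilde{x}\ge b-\epsilon e$, where $e$ is the all-ones vector in $\mathbb{R}^m$. The dual of $[P]$ is its Lagrangian dual, $\max_{\lambda\in\mathbb{R}^m,\ \lambda\ge 0}\ \min_{x\in\mathbb{R}^n}\{f(x)+\lambda^\top(b-Ax)\}$. The bit-complexity of the input is the length of the binary encoding of the rational data $(A,b,H,c)$. *)

theory Defs
  imports
    "Jordan_Normal_Form.Matrix"
    "HOL-Computational_Algebra.Polynomial"
    "HOL-Library.Extended_Real"
    "HOL-Library.Log_Nat"
begin

abbreviation real_mat :: "rat mat \<Rightarrow> real mat" where
  "real_mat \<equiv> map_mat real_of_rat"

abbreviation real_vec :: "rat vec \<Rightarrow> real vec" where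
  "real_vec \<equiv> map_vec real_of_rat"

text \<open>Symmetry is not part of this notion, so results about it cover symmetric positive definite
  matrices in particular.\<close>

definition positive_definite :: "nat \<Rightarrow> real mat \<Rightarrow> bool" where
  "positive_definite n H \<longleftrightarrow> H \<in> carrier_mat n n \<and>
     (\<forall>x \<in> carrier_vec n. x \<noteq> 0\<^sub>v n \<longrightarrow> 0 < x \<bullet> (H *\<^sub>v x))"

definition quad_obj :: "real mat \<Rightarrow> real vec \<Rightarrow> real vec \<Rightarrow> real" where
  "quad_obj H c x = x \<bullet> (H *\<^sub>v x) + c \<bullet> x"

text \<open>The order on vectors is the componentwise one.\<close>

definition feasible_set :: "real mat \<Rightarrow> real vec \<Rightarrow> real vec set" where
  "feasible_set A b = {x \<in> carrier_vec (dim_col A). A *\<^sub>v x \<ge> b}"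

definition eps_feasible :: "real mat \<Rightarrow> real vec \<Rightarrow> real \<Rightarrow> real vec \<Rightarrow> bool" where
  "eps_feasible A b \<epsilon> x \<longleftrightarrow>
     x \<in> carrier_vec (dim_col A) \<and> A *\<^sub>v x \<ge> b - \<epsilon> \<cdot>\<^sub>v vec (dim_row A) (\<lambda>_. 1)"

definition primal_optimal ::
    "real mat \<Rightarrow> real vec \<Rightarrow> real mat \<Rightarrow> real vec \<Rightarrow> real vec \<Rightarrow> bool" where
  "primal_optimal A b H c x \<longleftrightarrow>
     x \<in> feasible_set A b \<and> (\<forall>y \<in> feasible_set A b. quad_obj H c x \<le> quad_obj H c y)"

definition lagrangian ::
    "real mat \<Rightarrow> real vec \<Rightarrow> real mat \<Rightarrow> real vec \<Rightarrow> real vec \<Rightarrow> real vec \<Rightarrow> real" where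
  "lagrangian A b H c x l = quad_obj H c x + l \<bullet> (b - A *\<^sub>v x)"

text \<open>The inner minimum of the Lagrangian dual is taken as an infimum in the extended reals, so that
  it is meaningful without any assumption on the objective. For positive definite \<open>H\<close> it is
  attained.\<close>

definition dual_fun ::
    "real mat \<Rightarrow> real vec \<Rightarrow> real mat \<Rightarrow> real vec \<Rightarrow> real vec \<Rightarrow> ereal" where
  "dual_fun A b H c l = (INF x \<in> carrier_vec (dim_col A). ereal (lagrangian A b H c x l))"

definition dual_feasible_set :: "real mat \<Rightarrow> real vec set" where
  "dual_feasible_set A = {l \<in> carrier_vec (dim_row A). l \<ge> 0\<^sub>v (dim_row A)}"

definition dual_optimal ::
    "real mat \<Rightarrow> real vec \<Rightarrow> real mat \<Rightarrow> real vec \<Rightarrow> real vec \<Rightarrow> bool" where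
  "dual_optimal A b H c l \<longleftrightarrow>
     l \<in> dual_feasible_set A \<and>
     (\<forall>k \<in> dual_feasible_set A. dual_fun A b H c k \<le> dual_fun A b H c l)"

definition norm1_vec :: "real vec \<Rightarrow> real" where
  "norm1_vec v = (\<Sum>i < dim_vec v. \<bar>v $ i\<bar>)"

text \<open>Encoding lengths: a rational costs a sign bit plus the binary digits of numerator and
  denominator in lowest terms (\<open>quotient_of\<close>); vectors and matrices cost one unit per entry
  in addition to the entries themselves.\<close>

definition rat_bits :: "rat \<Rightarrow> nat" where
  "rat_bits r = 1 + nat (bitlen \<bar>fst (quotient_of r)\<bar>) + nat (bitlen (snd (quotient_of r)))"

definition vec_bits :: "rat vec \<Rightarrow> nat" where
  "vec_bits v = dim_vec v + (\<Sum>i < dim_vec v. rat_bits (v $ i))"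

definition mat_bits :: "rat mat \<Rightarrow> nat" where
  "mat_bits M = dim_row M * dim_col M + (\<Sum>i < dim_row M. \<Sum>j < dim_col M. rat_bits (M $$ (i, j)))"

definition input_bits :: "rat mat \<Rightarrow> rat vec \<Rightarrow> rat mat \<Rightarrow> rat vec \<Rightarrow> nat" where
  "input_bits A b H c = mat_bits A + vec_bits b + mat_bits H + vec_bits c"

end

theory Submission
  imports Defs "Jordan_Normal_Form.Determinant"
begin

text \<open>
  The bound on the objective is Lagrangian duality. For dual feasible \<open>l\<close> and \<open>\<epsilon>\<close>-feasible \<open>y\<close>, the
  Lagrangian satisfies \<open>L(y, l) = f(y) + l \<bullet> (b - A y) \<le> f(y) + \<epsilon> \<parallel>l\<parallel>\<^sub>1\<close> because \<open>l \<ge> 0\<close> and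
  \<open>b - A y \<le> \<epsilon> e\<close>. On the other hand, if \<open>l\<close> is dual optimal then \<open>L(y, l)\<close> is at least the dual
  value of \<open>l\<close>, which is at least \<open>f(x)\<close> by strong duality. Strong duality holds since an optimal \<open>x\<close>
  has a Karush-Kuhn-Tucker multiplier: no direction that keeps the active constraints can decrease
  \<open>f\<close> to first order, and Farkas' lemma turns this into a nonnegative combination of the active rows.
  By convexity \<open>x\<close> minimizes the Lagrangian at that multiplier, with value \<open>f(x)\<close>.

  The size bound concerns a particular dual optimal solution. By Caratheodory's argument the
  multiplier can be chosen basic, meaning that the rows of \<open>A\<close> in its support are linearly
  independent. The pair of \<open>x\<close> and \<open>l\<close> then solves a square linear system: stationarity, the constraints in the
  support of \<open>l\<close> with equality, and \<open>l\<^sub>i = 0\<close> outside of it. Positive definiteness together with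
  independence makes this system nonsingular, and its coefficients come from the input alone.
  After multiplication by a common denominator the system is integral, its
  determinant has absolute value at least 1, and Cramer's rule bounds each entry of \<open>l\<close> by
  a determinant. For input length \<open>L\<close>, the order of the system is at most \<open>L\<close> and its entries are at
  most \<open>2\<^bsup>2L+1\<^esup>\<close>, so that \<open>\<parallel>l\<parallel>\<^sub>1 \<le> L \<cdot> L! \<cdot> 2\<^bsup>(2L+1)L\<^esup> \<le> 2\<^bsup>3L^2+2L\<^esup>\<close>, a number whose encoding has quadratic
  length.

  The argument is carried by \<open>farkas\<close>, \<open>conic_caratheodory\<close>, \<open>dual_optimal_sensitivity\<close>,
  \<open>kkt_matrix_injective\<close> and \<open>integer_system_solution_bound\<close>.
\<close>

section \<open>Nonnegative combinations\<close>

text \<open>Bartl's elementary proof, by induction on the number of inequalities. If \<open>a k\<close> is needed to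
  imply \<open>g\<close>, some \<open>y\<close> satisfies the other inequalities and violates \<open>g\<close>, hence also \<open>a k\<close>.
  Shearing along \<open>y\<close> moves every point into the kernel of \<open>a k\<close>, where the remaining inequalities
  suffice for \<open>g\<close>; undoing the shear only adds a multiple of \<open>a k\<close>, and the signs at \<open>y\<close> make
  that multiple nonnegative.\<close>

lemma farkas:
  fixes a :: "'i \<Rightarrow> 'j \<Rightarrow> 'a :: linordered_field"
  assumes "finite I" and J: "finite J"
    and "\<And>x. \<forall>i\<in>I. 0 \<le> (\<Sum>j\<in>J. a i j * x j) \<Longrightarrow> 0 \<le> (\<Sum>j\<in>J. g j * x j)"
  shows "\<exists>l. (\<forall>i\<in>I. 0 \<le> l i) \<and> (\<forall>j\<in>J. g j = (\<Sum>i\<in>I. l i * a i j))"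
  using assms(1,3)
proof (induction I arbitrary: a g rule: finite_induct)
  case empty
  have "0 \<le> (\<Sum>j\<in>J. g j * - g j)"
    by (rule empty) simp
  then have "(\<Sum>j\<in>J. g j * g j) = 0"
    by (simp add: sum_negf sum_nonneg order.antisym)
  then show ?case
    using J by (simp add: sum_nonneg_eq_0_iff)
next
  case (insert k I)
  let ?ip = "\<lambda>u x. \<Sum>j\<in>J. u j * x j"
  show ?case
  proof (cases "\<forall>x. (\<forall>i\<in>I. 0 \<le> ?ip (a i) x) \<longrightarrow> 0 \<le> ?ip g x")
    case True
    then obtain l where l: "\<forall>i\<in>I. 0 \<le> l i" "\<forall>j\<in>J. g j = (\<Sum>i\<in>I. l i * a i j)"
      using insert.IH[of a g] by blast
    have "(\<Sum>i\<in>insert k I. (l(k := 0)) i * a i j) = (\<Sum>i\<in>I. l i * a i j)" for j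
      using insert.hyps by (auto intro!: sum.cong)
    then show ?thesis
      using l by (intro exI[of _ "l(k := 0)"]) simp
  next
    case False
    then obtain x0 where x0: "\<forall>i\<in>I. 0 \<le> ?ip (a i) x0" "?ip g x0 < 0"
      by (auto simp: not_le)
    then have neg: "?ip (a k) x0 < 0"
      using insert.prems[of x0] by (auto simp: not_le[symmetric])
    \<comment> \<open>Scaled so that \<open>a k\<close> takes the value \<open>-1\<close> at \<open>y\<close>: then \<open>x + (a k \<bullet> x) y\<close> lies in the kernel of \<open>a k\<close>.\<close>
    define y where "y j = x0 j / - ?ip (a k) x0" for j
    have ip_y: "?ip u y = ?ip u x0 / - ?ip (a k) x0" for u
      by (simp only: y_def sum_divide_distrib times_divide_eq_right)
    have ky: "?ip (a k) y = -1"
      using neg by (simp add: ip_y)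
    have iy: "0 \<le> ?ip (a i) y" if "i \<in> I" for i
      unfolding ip_y by (rule divide_nonneg_pos) (use x0 that neg in auto)
    have gy: "?ip g y < 0"
      unfolding ip_y by (rule divide_neg_pos) (use x0 neg in auto)
    \<comment> \<open>The functionals \<open>a i\<close> and \<open>g\<close> composed with the shear \<open>x \<mapsto> x + (a k \<bullet> x) y\<close>.\<close>
    define a' where "a' i j = a i j + ?ip (a i) y * a k j" for i j
    define g' where "g' j = g j + ?ip g y * a k j" for j
    have lin: "(\<Sum>j\<in>J. (u j + s * v j) * x j) = ?ip u x + s * ?ip v x"
      for u v x :: "'j \<Rightarrow> 'a" and s
      by (simp add: distrib_right sum.distrib sum_distrib_left mult.assoc)
    have lin': "?ip u (\<lambda>j. x j + s * y j) = ?ip u x + s * ?ip u y" for u x s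
      by (simp add: distrib_left sum.distrib sum_distrib_left mult.left_commute)
    have shift: "(\<Sum>j\<in>J. (u j + ?ip u y * a k j) * x j) = ?ip u (\<lambda>j. x j + ?ip (a k) x * y j)"
      for u x
      unfolding lin lin' by (rule arg_cong[OF mult.commute])
    have "0 \<le> ?ip g' x" if x: "\<forall>i\<in>I. 0 \<le> ?ip (a' i) x" for x
    proof -
      let ?z = "\<lambda>j. x j + ?ip (a k) x * y j"
      have "?ip (a k) ?z = 0"
        unfolding lin' ky by simp
      moreover have "\<forall>i\<in>I. 0 \<le> ?ip (a i) ?z"
        using x unfolding a'_def shift .
      ultimately show ?thesis
        unfolding g'_def shift by (intro insert.prems) (metis insert_iff order.refl)
    qed
    then obtain l where l: "\<forall>i\<in>I. 0 \<le> l i" "\<forall>j\<in>J. g' j = (\<Sum>i\<in>I. l i * a' i j)"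
      using insert.IH[of a' g'] by blast
    \<comment> \<open>The coefficient of \<open>a k\<close> that remains when \<open>a'\<close> and \<open>g'\<close> are expanded.\<close>
    define r where "r = (\<Sum>i\<in>I. l i * ?ip (a i) y) - ?ip g y"
    have "0 \<le> r"
      unfolding r_def using gy sum_nonneg[of I "\<lambda>i. l i * ?ip (a i) y"] l(1) iy by fastforce
    moreover have "g j = (\<Sum>i\<in>insert k I. (l(k := r)) i * a i j)" if "j \<in> J" for j
    proof -
      have "(\<Sum>i\<in>insert k I. (l(k := r)) i * a i j) = r * a k j + (\<Sum>i\<in>I. l i * a i j)"
        using insert.hyps by (auto intro!: sum.cong)
      moreover have "g' j = (\<Sum>i\<in>I. l i * a i j) + (\<Sum>i\<in>I. l i * ?ip (a i) y) * a k j"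
      proof -
        have "(\<Sum>i\<in>I. l i * (a i j + e i * a k j)) =
          (\<Sum>i\<in>I. l i * a i j) + (\<Sum>i\<in>I. l i * e i) * a k j" for e
          by (simp add: distrib_left sum.distrib sum_distrib_right mult.assoc)
        then show ?thesis
          using l(2) that by (simp only: a'_def)
      qed
      ultimately show ?thesis
        unfolding r_def g'_def left_diff_distrib by linarith
    qed
    ultimately show ?thesis
      using l(1) by (intro exI[of _ "l(k := r)"]) auto
  qed
qed

text \<open>Take a representation with support of least size. Along a linear dependency within the support
  one could move until the first coefficient vanishes, which would shrink the support; hence the
  vectors in the support are independent, which is the third conjunct.\<close>

lemma conic_caratheodory:
  fixes a :: "'i \<Rightarrow> 'j \<Rightarrow> 'a :: linordered_field"
  assumes I: "finite I" and nonneg: "\<forall>i\<in>I. 0 \<le> l i"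
  shows "\<exists>l'. (\<forall>i\<in>I. 0 \<le> l' i) \<and> (\<forall>j\<in>J. (\<Sum>i\<in>I. l' i * a i j) = (\<Sum>i\<in>I. l i * a i j)) \<and>
    (\<forall>u. (\<forall>i\<in>I. l' i = 0 \<longrightarrow> u i = 0) \<longrightarrow> (\<forall>j\<in>J. (\<Sum>i\<in>I. u i * a i j) = 0) \<longrightarrow> (\<forall>i\<in>I. u i = 0))"
proof -
  define rep where "rep l' \<longleftrightarrow> (\<forall>i\<in>I. 0 \<le> l' i) \<and>
    (\<forall>j\<in>J. (\<Sum>i\<in>I. l' i * a i j) = (\<Sum>i\<in>I. l i * a i j))" for l'
  have "rep l"
    using nonneg by (simp add: rep_def)
  then obtain l' where l': "rep l'"
    and least: "\<And>k. rep k \<Longrightarrow> card {i\<in>I. l' i \<noteq> 0} \<le> card {i\<in>I. k i \<noteq> 0}"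
    using ex_has_least_nat[of rep l "\<lambda>k. card {i\<in>I. k i \<noteq> 0}"] by blast
  \<comment> \<open>A dependency \<open>u\<close> has no negative entry; applied to \<open>- u\<close>, this leaves only \<open>u = 0\<close>.\<close>
  have no_neg: "\<not> u i0 < 0" if supp: "\<forall>i\<in>I. l' i = 0 \<longrightarrow> u i = 0"
    and null: "\<forall>j\<in>J. (\<Sum>i\<in>I. u i * a i j) = 0" and i0: "i0 \<in> I" for u i0
  proof
    assume "u i0 < 0"
    define N where "N = {i\<in>I. u i < 0}"
    have N: "finite N" "N \<noteq> {}"
      using I i0 \<open>u i0 < 0\<close> by (auto simp: N_def)
    \<comment> \<open>The largest step along \<open>u\<close> that keeps all coefficients nonnegative.\<close>
    define t where "t = Min ((\<lambda>i. l' i / - u i) ` N)"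
    have "t \<in> (\<lambda>i. l' i / - u i) ` N"
      unfolding t_def using N by (intro Min_in) auto
    then obtain i1 where i1: "i1 \<in> N" "t = l' i1 / - u i1"
      by blast
    have t_le: "t \<le> l' i / - u i" if "i \<in> N" for i
      unfolding t_def using N that by (intro Min_le) auto
    have "0 \<le> t"
      unfolding i1(2) using i1(1) l' by (intro divide_nonneg_pos) (auto simp: N_def rep_def)
    define k where "k i = l' i + t * u i" for i
    have "0 \<le> k i" if "i \<in> I" for i
    proof (cases "u i < 0")
      case True
      then have "t * - u i \<le> l' i"
        using t_le[of i] that pos_le_divide_eq[of "- u i" t "l' i"] by (simp add: N_def)
      then show ?thesis
        by (simp add: k_def)
    next
      case False
      then show ?thesis
        using \<open>0 \<le> t\<close> that l' by (simp add: k_def rep_def)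
    qed
    moreover have "(\<Sum>i\<in>I. k i * a i j) = (\<Sum>i\<in>I. l i * a i j)" if "j \<in> J" for j
    proof -
      have "(\<Sum>i\<in>I. k i * a i j) = (\<Sum>i\<in>I. l' i * a i j) + t * (\<Sum>i\<in>I. u i * a i j)"
        by (simp add: k_def distrib_right sum.distrib sum_distrib_left mult.assoc)
      then show ?thesis
        using that null l' by (simp add: rep_def)
    qed
    ultimately have "rep k"
      by (simp add: rep_def)
    moreover have "{i\<in>I. k i \<noteq> 0} \<subset> {i\<in>I. l' i \<noteq> 0}"
    proof -
      have "k i1 = 0" "i1 \<in> I" "l' i1 \<noteq> 0"
        using i1 supp by (auto simp: k_def N_def)
      moreover have "l' i \<noteq> 0" if "i \<in> I" "k i \<noteq> 0" for i
        using that supp by (auto simp: k_def)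
      ultimately show ?thesis
        by blast
    qed
    ultimately show False
      using least[of k] psubset_card_mono[of "{i\<in>I. l' i \<noteq> 0}" "{i\<in>I. k i \<noteq> 0}"] I
      by (simp add: not_less[symmetric])
  qed
  have "\<forall>i\<in>I. u i = 0" if supp: "\<forall>i\<in>I. l' i = 0 \<longrightarrow> u i = 0"
    and null: "\<forall>j\<in>J. (\<Sum>i\<in>I. u i * a i j) = 0" for u
  proof
    fix i assume "i \<in> I"
    then show "u i = 0"
      using no_neg[OF supp null, of i] no_neg[of "\<lambda>i. - u i" i] supp null
      by (simp add: sum_negf)
  qed
  then show ?thesis
    using l' unfolding rep_def by (intro exI[of _ l'] conjI allI impI) simp_all
qed

section \<open>Optimality conditions and duality\<close>

text \<open>Since \<open>H\<close> need not be symmetric, the quadratic part contributes \<open>H + H\<^sup>T\<close> instead of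
  \<open>2 H\<close>.\<close>

definition gradient :: "real mat \<Rightarrow> real vec \<Rightarrow> real vec \<Rightarrow> real vec" where
  "gradient H c x = (H + transpose_mat H) *\<^sub>v x + c"

lemma gradient_carrier:
  assumes "H \<in> carrier_mat n n" "c \<in> carrier_vec n"
  shows "gradient H c x \<in> carrier_vec n"
  using assms unfolding gradient_def by (metis add_carrier_vec carrier_vecI dim_mult_mat_vec
      index_add_mat(2) carrier_matD(2) index_transpose_mat(2))

lemma quad_obj_add:
  assumes H: "H \<in> carrier_mat n n" and c: "c \<in> carrier_vec n"
    and x: "x \<in> carrier_vec n" and d: "d \<in> carrier_vec n"
  shows "quad_obj H c (x + d) = quad_obj H c x + gradient H c x \<bullet> d + d \<bullet> (H *\<^sub>v d)"
proof -
  have Hx: "H *\<^sub>v x \<in> carrier_vec n" and Hd: "H *\<^sub>v d \<in> carrier_vec n"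
    and Htx: "transpose_mat H *\<^sub>v x \<in> carrier_vec n" and Ht: "transpose_mat H \<in> carrier_mat n n"
    using H x d by auto
  have "gradient H c x \<bullet> d = (H *\<^sub>v x) \<bullet> d + (transpose_mat H *\<^sub>v x) \<bullet> d + c \<bullet> d"
    unfolding gradient_def add_mult_distrib_mat_vec[OF H Ht x]
    using Hx Htx c d by (simp add: add_scalar_prod_distrib[of _ n])
  also have "\<dots> = d \<bullet> (H *\<^sub>v x) + x \<bullet> (H *\<^sub>v d) + c \<bullet> d"
    using comm_scalar_prod[OF Hx d] transpose_vec_mult_scalar[OF H d x] by simp
  finally show ?thesis
    unfolding quad_obj_def mult_add_distrib_mat_vec[OF H x d]
    using H c x d Hx Hd
    by (simp add: scalar_prod_add_distrib[of _ n] add_scalar_prod_distrib[of _ n])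
qed

text \<open>Otherwise a short step in direction \<open>d\<close> would decrease the objective and stay feasible: active
  constraints do not decrease along \<open>d\<close>, and inactive ones have slack.\<close>

lemma primal_optimal_first_order:
  assumes A: "A \<in> carrier_mat m n" and H: "H \<in> carrier_mat n n" and c: "c \<in> carrier_vec n"
    and opt: "primal_optimal A b H c x" and d: "d \<in> carrier_vec n"
    and active: "\<And>i. i < m \<Longrightarrow> (A *\<^sub>v x) $ i = b $ i \<Longrightarrow> 0 \<le> (A *\<^sub>v d) $ i"
  shows "0 \<le> gradient H c x \<bullet> d"
proof (rule ccontr)
  assume "\<not> 0 \<le> gradient H c x \<bullet> d"
  then have neg: "gradient H c x \<bullet> d < 0"
    by simp
  have x: "x \<in> carrier_vec n" and b: "dim_vec b = m" and Ax: "\<And>i. i < m \<Longrightarrow> b $ i \<le> (A *\<^sub>v x) $ i"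
    using opt A by (auto simp: primal_optimal_def feasible_set_def less_eq_vec_def)
  have G: "gradient H c x \<in> carrier_vec n"
    by (rule gradient_carrier[OF H c])
  have "((\<lambda>t. gradient H c x \<bullet> d + t * (d \<bullet> (H *\<^sub>v d))) \<longlongrightarrow> gradient H c x \<bullet> d + 0 * (d \<bullet> (H *\<^sub>v d)))
      (at_right 0)"
    by (intro tendsto_intros)
  then have descent: "\<forall>\<^sub>F t in at_right 0. gradient H c x \<bullet> d + t * (d \<bullet> (H *\<^sub>v d)) < 0"
    using neg by (intro order_tendstoD(2)) auto
  have "\<forall>\<^sub>F t in at_right 0. b $ i \<le> (A *\<^sub>v x) $ i + t * (A *\<^sub>v d) $ i" if i: "i < m" for i
  proof (cases "(A *\<^sub>v x) $ i = b $ i")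
    case True
    then show ?thesis
      using active[OF i] by (auto simp: eventually_at_filter)
  next
    case False
    have "((\<lambda>t. (A *\<^sub>v x) $ i + t * (A *\<^sub>v d) $ i) \<longlongrightarrow> (A *\<^sub>v x) $ i + 0 * (A *\<^sub>v d) $ i) (at_right 0)"
      by (intro tendsto_intros)
    then have "\<forall>\<^sub>F t in at_right 0. b $ i < (A *\<^sub>v x) $ i + t * (A *\<^sub>v d) $ i"
      using False Ax[OF i] by (intro order_tendstoD(1)) auto
    then show ?thesis
      by (rule eventually_mono) simp
  qed
  then have "\<forall>\<^sub>F t in at_right 0. \<forall>i\<in>{..<m}. b $ i \<le> (A *\<^sub>v x) $ i + t * (A *\<^sub>v d) $ i"
    by (intro eventually_ball_finite) auto
  moreover have "\<forall>\<^sub>F t in at_right (0 :: real). 0 < t"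
    by (auto simp: eventually_at_filter)
  ultimately obtain t where t: "0 < t" "gradient H c x \<bullet> d + t * (d \<bullet> (H *\<^sub>v d)) < 0"
    "\<forall>i\<in>{..<m}. b $ i \<le> (A *\<^sub>v x) $ i + t * (A *\<^sub>v d) $ i"
    using eventually_happens'[OF trivial_limit_at_right_real, OF eventually_conj[OF _ eventually_conj[OF descent]]]
    by blast
  have td: "t \<cdot>\<^sub>v d \<in> carrier_vec n"
    using d by simp
  have "A *\<^sub>v (x + t \<cdot>\<^sub>v d) = A *\<^sub>v x + t \<cdot>\<^sub>v (A *\<^sub>v d)"
    using A x d td by (simp add: mult_add_distrib_mat_vec[of _ m n] mult_mat_vec[of _ m n])
  then have "x + t \<cdot>\<^sub>v d \<in> feasible_set A b"
    using t(3) A x d b by (auto simp: feasible_set_def less_eq_vec_def simp del: index_mult_mat_vec)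
  then have "quad_obj H c x \<le> quad_obj H c (x + t \<cdot>\<^sub>v d)"
    using opt by (simp add: primal_optimal_def)
  moreover have "quad_obj H c (x + t \<cdot>\<^sub>v d) =
      quad_obj H c x + t * (gradient H c x \<bullet> d + t * (d \<bullet> (H *\<^sub>v d)))"
    unfolding quad_obj_add[OF H c x td] using H d G
    by (simp add: mult_mat_vec[of _ n n] distrib_left)
  ultimately show False
    using mult_pos_neg[OF t(1,2)] by simp
qed

definition kkt_multiplier ::
    "real mat \<Rightarrow> real vec \<Rightarrow> real mat \<Rightarrow> real vec \<Rightarrow> real vec \<Rightarrow> real vec \<Rightarrow> bool" where
  "kkt_multiplier A b H c x l \<longleftrightarrow>
     l \<in> dual_feasible_set A \<and> gradient H c x = transpose_mat A *\<^sub>v l \<and>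
     (\<forall>i < dim_row A. l $ i = 0 \<or> (A *\<^sub>v x) $ i = b $ i)"

text \<open>Linear independence of the rows of \<open>A\<close> in the support of \<open>l\<close>, phrased through vectors \<open>u\<close> of
  full length that vanish off the support.\<close>

definition basic_multiplier :: "real mat \<Rightarrow> real vec \<Rightarrow> bool" where
  "basic_multiplier A l \<longleftrightarrow>
     (\<forall>u \<in> carrier_vec (dim_row A). (\<forall>i < dim_row A. l $ i = 0 \<longrightarrow> u $ i = 0) \<longrightarrow>
        transpose_mat A *\<^sub>v u = 0\<^sub>v (dim_col A) \<longrightarrow> u = 0\<^sub>v (dim_row A))"

text \<open>The first-order condition is the hypothesis of Farkas' lemma for the active rows of \<open>A\<close> and
  the gradient; Caratheodory's argument then makes the resulting multiplier basic.\<close>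

lemma primal_optimal_imp_basic_kkt_multiplier:
  assumes A: "A \<in> carrier_mat m n" and H: "H \<in> carrier_mat n n" and c: "c \<in> carrier_vec n"
    and opt: "primal_optimal A b H c x"
  shows "\<exists>l. kkt_multiplier A b H c x l \<and> basic_multiplier A l"
proof -
  define I where "I = {i. i < m \<and> (A *\<^sub>v x) $ i = b $ i}"
  have I: "finite I" "I \<subseteq> {0..<m}"
    by (auto simp: I_def)
  have G: "gradient H c x \<in> carrier_vec n"
    by (rule gradient_carrier[OF H c])
  have "0 \<le> (\<Sum>j\<in>{0..<n}. gradient H c x $ j * d j)"
    if d: "\<forall>i\<in>I. 0 \<le> (\<Sum>j\<in>{0..<n}. A $$ (i, j) * d j)" for d
  proof -
    have "0 \<le> gradient H c x \<bullet> vec n d"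
    proof (rule primal_optimal_first_order[OF A H c opt])
      fix i assume "i < m" "(A *\<^sub>v x) $ i = b $ i"
      then show "0 \<le> (A *\<^sub>v vec n d) $ i"
        using d A by (simp add: I_def scalar_prod_def)
    qed simp
    then show ?thesis
      by (simp add: scalar_prod_def)
  qed
  then obtain k where k: "\<forall>i\<in>I. 0 \<le> k i"
    "\<forall>j\<in>{0..<n}. gradient H c x $ j = (\<Sum>i\<in>I. k i * A $$ (i, j))"
    using farkas[OF I(1), of "{0..<n}" "\<lambda>i j. A $$ (i, j)" "\<lambda>j. gradient H c x $ j"] by auto
  obtain k' where k': "\<forall>i\<in>I. 0 \<le> k' i"
    "\<forall>j\<in>{0..<n}. (\<Sum>i\<in>I. k' i * A $$ (i, j)) = (\<Sum>i\<in>I. k i * A $$ (i, j))"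
    "\<And>u. \<forall>i\<in>I. k' i = 0 \<longrightarrow> u i = 0 \<Longrightarrow> \<forall>j\<in>{0..<n}. (\<Sum>i\<in>I. u i * A $$ (i, j)) = 0 \<Longrightarrow>
      \<forall>i\<in>I. u i = 0"
    using conic_caratheodory[OF I(1) k(1), of "{0..<n}" "\<lambda>i j. A $$ (i, j)"] by blast
  define l where "l = vec m (\<lambda>i. if i \<in> I then k' i else 0)"
  have At: "(transpose_mat A *\<^sub>v u) $ j = (\<Sum>i\<in>I. u $ i * A $$ (i, j))"
    if u: "u \<in> carrier_vec m" "\<forall>i<m. i \<notin> I \<longrightarrow> u $ i = 0" and j: "j < n" for u j
  proof -
    have "(transpose_mat A *\<^sub>v u) $ j = (\<Sum>i\<in>{0..<m}. u $ i * A $$ (i, j))"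
      using A u(1) j by (simp add: scalar_prod_def mult.commute)
    also have "\<dots> = (\<Sum>i\<in>I. u $ i * A $$ (i, j))"
      using I u by (intro sum.mono_neutral_right) auto
    finally show ?thesis .
  qed
  have "gradient H c x = transpose_mat A *\<^sub>v l"
  proof (rule eq_vecI)
    fix j assume "j < dim_vec (transpose_mat A *\<^sub>v l)"
    then have j: "j < n"
      using A by simp
    have "(transpose_mat A *\<^sub>v l) $ j = (\<Sum>i\<in>I. l $ i * A $$ (i, j))"
      by (rule At[OF _ _ j]) (auto simp: l_def)
    also have "\<dots> = (\<Sum>i\<in>I. k' i * A $$ (i, j))"
      using I by (intro sum.cong) (auto simp: l_def)
    finally show "gradient H c x $ j = (transpose_mat A *\<^sub>v l) $ j"
      using k(2) k'(2) j by simp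
  qed (use G A in simp)
  then have "kkt_multiplier A b H c x l"
    using A k'(1) by (auto simp: kkt_multiplier_def dual_feasible_set_def less_eq_vec_def l_def I_def)
  moreover have "basic_multiplier A l"
    unfolding basic_multiplier_def
  proof (intro ballI impI)
    fix u assume "u \<in> carrier_vec (dim_row A)" and supp: "\<forall>i<dim_row A. l $ i = 0 \<longrightarrow> u $ i = 0"
      and null: "transpose_mat A *\<^sub>v u = 0\<^sub>v (dim_col A)"
    then have u: "u \<in> carrier_vec m"
      using A by simp
    have out: "\<forall>i<m. i \<notin> I \<longrightarrow> u $ i = 0"
      using supp A by (auto simp: l_def)
    have "\<forall>i\<in>I. u $ i = 0"
    proof (rule k'(3))
      show "\<forall>i\<in>I. k' i = 0 \<longrightarrow> u $ i = 0"
        using supp A by (auto simp: l_def I_def)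
      show "\<forall>j\<in>{0..<n}. (\<Sum>i\<in>I. u $ i * A $$ (i, j)) = 0"
        using At[OF u out] null A by simp
    qed
    then show "u = 0\<^sub>v (dim_row A)"
      using u out A by (intro eq_vecI) auto
  qed
  ultimately show ?thesis
    by blast
qed

text \<open>The Lagrangian at \<open>l\<close> is convex in \<open>y\<close> and, by stationarity, has a critical point at \<open>x\<close>;
  complementary slackness makes its value there the objective value. Concretely, with \<open>d = y - x\<close>,
  the linear terms cancel and the difference is \<open>d \<bullet> (H d)\<close>.\<close>

lemma lagrangian_ge_at_kkt_multiplier:
  assumes A: "A \<in> carrier_mat m n" and b: "b \<in> carrier_vec m" and c: "c \<in> carrier_vec n"
    and pd: "positive_definite n H" and x: "x \<in> carrier_vec n"
    and kkt: "kkt_multiplier A b H c x l" and y: "y \<in> carrier_vec n"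
  shows "quad_obj H c x \<le> lagrangian A b H c y l"
proof -
  have H: "H \<in> carrier_mat n n"
    using pd by (simp add: positive_definite_def)
  have l: "l \<in> carrier_vec m" and G: "gradient H c x = transpose_mat A *\<^sub>v l"
    and slack: "\<And>i. i < m \<Longrightarrow> l $ i = 0 \<or> (A *\<^sub>v x) $ i = b $ i"
    using kkt A by (auto simp: kkt_multiplier_def dual_feasible_set_def)
  define d where "d = y - x"
  have d: "d \<in> carrier_vec n" and y_eq: "y = x + d"
    using x y by (auto simp: d_def)
  have Ax: "A *\<^sub>v x \<in> carrier_vec m" and Ad: "A *\<^sub>v d \<in> carrier_vec m"
    using A x d by auto
  have "0 \<le> d \<bullet> (H *\<^sub>v d)"
  proof (cases "d = 0\<^sub>v n")
    case True
    then show ?thesis using H by simp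
  next
    case False
    then show ?thesis using pd d by (simp add: positive_definite_def less_imp_le)
  qed
  moreover have "l \<bullet> (b - A *\<^sub>v y) = - (gradient H c x \<bullet> d)"
  proof -
    have "b - A *\<^sub>v y = (b - A *\<^sub>v x) - A *\<^sub>v d"
      unfolding y_eq mult_add_distrib_mat_vec[OF A x d] using b Ax Ad by (intro eq_vecI) auto
    then have "l \<bullet> (b - A *\<^sub>v y) = l \<bullet> (b - A *\<^sub>v x) - l \<bullet> (A *\<^sub>v d)"
      using l b Ax Ad by (simp add: scalar_prod_minus_distrib[of _ m])
    also have "l \<bullet> (b - A *\<^sub>v x) = 0"
      unfolding scalar_prod_def
    proof (rule sum.neutral, intro ballI)
      fix i assume "i \<in> {0..<dim_vec (b - A *\<^sub>v x)}"
      then have "i < m"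
        using A by simp
      then show "l $ i * (b - A *\<^sub>v x) $ i = 0"
        using slack[of i] A b by auto
    qed
    finally show ?thesis
      using transpose_vec_mult_scalar[OF A d l] G by simp
  qed
  ultimately show ?thesis
    unfolding lagrangian_def y_eq quad_obj_add[OF H c x d] by simp
qed

text \<open>Weak duality with an error term. For \<open>\<epsilon> = 0\<close> it is weak duality at a feasible point, for general
  \<open>\<epsilon>\<close> it produces the term \<open>\<parallel>l\<parallel>\<^sub>1 \<epsilon>\<close> of the sensitivity bound.\<close>

lemma lagrangian_le_at_eps_feasible:
  assumes A: "A \<in> carrier_mat m n" and b: "b \<in> carrier_vec m"
    and l: "l \<in> dual_feasible_set A" and x: "eps_feasible A b \<epsilon> x"
  shows "lagrangian A b H c x l \<le> quad_obj H c x + norm1_vec l * \<epsilon>"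
proof -
  have lm: "l \<in> carrier_vec m"
    using l A by (simp add: dual_feasible_set_def)
  have "0\<^sub>v m \<le> l"
    using l A by (simp add: dual_feasible_set_def)
  then have pos: "0 \<le> l $ i" if "i < m" for i
    using lm that unfolding less_eq_vec_def by (metis carrier_vecD index_zero_vec(1))
  have le: "b $ i - (A *\<^sub>v x) $ i \<le> \<epsilon>" if "i < m" for i
    using x A b that by (auto simp: eps_feasible_def less_eq_vec_def simp del: index_mult_mat_vec)
  have "l \<bullet> (b - A *\<^sub>v x) = (\<Sum>i<m. l $ i * (b $ i - (A *\<^sub>v x) $ i))"
    unfolding scalar_prod_def using A b by (intro sum.cong) auto
  also have "\<dots> \<le> (\<Sum>i<m. l $ i * \<epsilon>)"
    by (intro sum_mono mult_left_mono) (use le pos in auto)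
  also have "\<dots> = norm1_vec l * \<epsilon>"
    using pos lm by (auto simp: norm1_vec_def sum_distrib_right)
  finally show ?thesis
    by (simp add: lagrangian_def)
qed

lemma feasible_imp_eps_feasible_0:
  assumes "x \<in> feasible_set A b"
  shows "eps_feasible A b 0 x"
  using assms by (simp add: feasible_set_def eps_feasible_def less_eq_vec_def)

lemma dual_fun_le_lagrangian:
  assumes "A \<in> carrier_mat m n" "x \<in> carrier_vec n"
  shows "dual_fun A b H c l \<le> ereal (lagrangian A b H c x l)"
  unfolding dual_fun_def using assms by (intro INF_lower) auto

lemma dual_fun_at_kkt_multiplier:
  assumes "A \<in> carrier_mat m n" "b \<in> carrier_vec m" "c \<in> carrier_vec n"
    and "positive_definite n H" "x \<in> carrier_vec n" "kkt_multiplier A b H c x l"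
  shows "ereal (quad_obj H c x) \<le> dual_fun A b H c l"
  unfolding dual_fun_def
  using lagrangian_ge_at_kkt_multiplier[OF assms] assms(1) by (intro INF_greatest) auto

text \<open>By weak duality no dual value exceeds \<open>f(x)\<close>, and a Karush-Kuhn-Tucker multiplier attains it.\<close>

lemma kkt_multiplier_dual_optimal:
  assumes A: "A \<in> carrier_mat m n" and b: "b \<in> carrier_vec m" and c: "c \<in> carrier_vec n"
    and pd: "positive_definite n H" and x: "x \<in> feasible_set A b"
    and kkt: "kkt_multiplier A b H c x l"
  shows "dual_optimal A b H c l"
  unfolding dual_optimal_def
proof (intro conjI ballI)
  show "l \<in> dual_feasible_set A"
    using kkt by (simp add: kkt_multiplier_def)
next
  fix k assume k: "k \<in> dual_feasible_set A"
  have xn: "x \<in> carrier_vec n"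
    using x A by (simp add: feasible_set_def)
  have "dual_fun A b H c k \<le> ereal (lagrangian A b H c x k)"
    by (rule dual_fun_le_lagrangian[OF A xn])
  also have "\<dots> \<le> ereal (quad_obj H c x)"
    using lagrangian_le_at_eps_feasible[OF A b k feasible_imp_eps_feasible_0[OF x]] by simp
  also have "\<dots> \<le> dual_fun A b H c l"
    by (rule dual_fun_at_kkt_multiplier[OF A b c pd xn kkt])
  finally show "dual_fun A b H c k \<le> dual_fun A b H c l" .
qed

text \<open>The dual value of \<open>l\<close> is at least that of a Karush-Kuhn-Tucker multiplier, hence at least \<open>f(x)\<close>. The Lagrangian at the perturbed point \<open>y\<close> bounds the
  dual value from above.\<close>

lemma dual_optimal_sensitivity:
  assumes A: "A \<in> carrier_mat m n" and b: "b \<in> carrier_vec m" and c: "c \<in> carrier_vec n"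
    and pd: "positive_definite n H" and opt: "primal_optimal A b H c x"
    and l: "dual_optimal A b H c l" and y: "eps_feasible A b \<epsilon> y"
  shows "quad_obj H c x - norm1_vec l * \<epsilon> \<le> quad_obj H c y"
proof -
  have H: "H \<in> carrier_mat n n"
    using pd by (simp add: positive_definite_def)
  obtain k where k: "kkt_multiplier A b H c x k"
    using primal_optimal_imp_basic_kkt_multiplier[OF A H c opt] by blast
  have xn: "x \<in> carrier_vec n" and yn: "y \<in> carrier_vec n"
    using opt y A by (auto simp: primal_optimal_def feasible_set_def eps_feasible_def)
  have "ereal (quad_obj H c x) \<le> dual_fun A b H c k"
    by (rule dual_fun_at_kkt_multiplier[OF A b c pd xn k])
  also have "\<dots> \<le> dual_fun A b H c l"
    using l k by (simp add: dual_optimal_def kkt_multiplier_def)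
  also have "\<dots> \<le> ereal (lagrangian A b H c y l)"
    by (rule dual_fun_le_lagrangian[OF A yn])
  also have "\<dots> \<le> ereal (quad_obj H c y + norm1_vec l * \<epsilon>)"
    using lagrangian_le_at_eps_feasible[OF A b _ y] l by (simp add: dual_optimal_def)
  finally show ?thesis
    by simp
qed

section \<open>Solutions of integral linear systems\<close>

lemma abs_det_le:
  fixes M :: "real mat"
  assumes M: "M \<in> carrier_mat N N"
    and bound: "\<And>i j. i < N \<Longrightarrow> j < N \<Longrightarrow> \<bar>M $$ (i, j)\<bar> \<le> B"
  shows "\<bar>det M\<bar> \<le> fact N * B ^ N"
proof -
  have "\<bar>det M\<bar> \<le> (\<Sum>p | p permutes {0..<N}. \<bar>signof p * (\<Prod>i = 0..<N. M $$ (i, p i))\<bar>)"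
    unfolding det_def'[OF M] by (rule sum_abs)
  also have "\<dots> \<le> (\<Sum>p | p permutes {0..<N}. B ^ N)"
  proof (rule sum_mono)
    fix p assume "p \<in> {p. p permutes {0..<N}}"
    then have p: "p i < N" if "i < N" for i
      using that permutes_in_image[of p "{0..<N}" i] by simp
    have "\<bar>signof p * (\<Prod>i = 0..<N. M $$ (i, p i))\<bar> = (\<Prod>i = 0..<N. \<bar>M $$ (i, p i)\<bar>)"
      using signof_pm_one[of p, where 'a = real] by (auto simp: abs_mult abs_prod)
    also have "\<dots> \<le> (\<Prod>i = 0..<N. B)"
      by (rule prod_mono) (use bound p in auto)
    finally show "\<bar>signof p * (\<Prod>i = 0..<N. M $$ (i, p i))\<bar> \<le> B ^ N"
      by simp
  qed
  also have "\<dots> = fact N * B ^ N"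
    by (simp add: card_permutations[of _ N])
  finally show ?thesis .
qed

lemma det_Ints:
  fixes M :: "real mat"
  assumes M: "M \<in> carrier_mat N N"
    and int: "\<And>i j. i < N \<Longrightarrow> j < N \<Longrightarrow> M $$ (i, j) \<in> \<int>"
  shows "det M \<in> \<int>"
  unfolding det_def'[OF M]
proof (intro Ints_sum Ints_mult Ints_prod)
  fix p :: "nat \<Rightarrow> nat"
  show "signof p \<in> (\<int> :: real set)"
    using signof_pm_one[of p, where 'a = real] by auto
next
  fix p i assume "p \<in> {p. p permutes {0..<N}}" "i \<in> {0..<N}"
  then show "M $$ (i, p i) \<in> \<int>"
    using int permutes_in_image[of p "{0..<N}" i] by simp
qed

text \<open>By Cramer's rule \<open>z $ k\<close> is a quotient of two integer determinants; the denominator is nonzero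
  and therefore at least 1 in absolute value.\<close>

lemma integer_system_solution_bound:
  fixes M :: "real mat"
  assumes M: "M \<in> carrier_mat N N" and z: "z \<in> carrier_vec N" and k: "k < N"
    and inj: "\<And>v. v \<in> carrier_vec N \<Longrightarrow> M *\<^sub>v v = 0\<^sub>v N \<Longrightarrow> v = 0\<^sub>v N"
    and M_int: "\<And>i j. i < N \<Longrightarrow> j < N \<Longrightarrow> M $$ (i, j) \<in> \<int> \<and> \<bar>M $$ (i, j)\<bar> \<le> B"
    and rhs_int: "\<And>i. i < N \<Longrightarrow> (M *\<^sub>v z) $ i \<in> \<int> \<and> \<bar>(M *\<^sub>v z) $ i\<bar> \<le> B"
  shows "\<bar>z $ k\<bar> \<le> fact N * B ^ N"
proof -
  let ?R = "replace_col M (M *\<^sub>v z) k"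
  have R: "?R \<in> carrier_mat N N"
    using M by (simp add: replace_col_def)
  have R_entry: "?R $$ (i, j) = (if j = k then (M *\<^sub>v z) $ i else M $$ (i, j))"
    if "i < N" "j < N" for i j
    using that M by (simp add: replace_col_def)
  have "det M \<noteq> 0"
    using inj det_0_iff_vec_prod_zero_field[OF M] by blast
  moreover have "det M \<in> \<int>"
    using det_Ints[OF M] M_int by blast
  ultimately have "1 \<le> \<bar>det M\<bar>"
    using Ints_nonzero_abs_ge1 by blast
  then have "\<bar>z $ k\<bar> * 1 \<le> \<bar>z $ k\<bar> * \<bar>det M\<bar>"
    by (intro mult_left_mono) auto
  also have "\<dots> = \<bar>det ?R\<bar>"
    by (simp add: cramer_lemma_mat[OF M z k] abs_mult)
  also have "\<dots> \<le> fact N * B ^ N"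
    by (rule abs_det_le[OF R]) (use M_int rhs_int R_entry in auto)
  finally show ?thesis
    by simp
qed

section \<open>Encoding lengths and common denominators\<close>

lemma denominator_le: "snd (quotient_of r) \<le> 2 ^ rat_bits r"
proof -
  have "snd (quotient_of r) < 2 ^ nat (bitlen (snd (quotient_of r)))"
    using bitlen_bounds[OF quotient_of_denom_pos'] by blast
  also have "\<dots> \<le> (2 :: int) ^ rat_bits r"
    by (intro power_increasing) (auto simp: rat_bits_def)
  finally show ?thesis by simp
qed

lemma denominator_times: "of_int (snd (quotient_of r)) * r = of_int (fst (quotient_of r))"
  using quotient_of_denom_pos'[of r] quotient_of_div[of r "fst (quotient_of r)" "snd (quotient_of r)"]
  by (metis less_irrefl nonzero_mult_div_cancel_left of_int_eq_0_iff prod.collapse times_divide_eq_right)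

lemma abs_rat_le: "\<bar>r\<bar> \<le> 2 ^ rat_bits r"
proof -
  let ?p = "fst (quotient_of r)" and ?q = "snd (quotient_of r)"
  have "\<bar>?p\<bar> \<le> 2 ^ nat (bitlen \<bar>?p\<bar>)"
    by (cases "?p = 0") (use bitlen_bounds[of "\<bar>?p\<bar>"] in auto)
  also have "\<dots> \<le> (2 :: int) ^ rat_bits r"
    by (intro power_increasing) (auto simp: rat_bits_def)
  finally have p: "of_int \<bar>?p\<bar> \<le> (2 :: rat) ^ rat_bits r"
    by (metis of_int_le_iff of_int_numeral of_int_power)
  have "\<bar>r\<bar> * 1 \<le> \<bar>r\<bar> * of_int ?q"
    using quotient_of_denom_pos'[of r] by (intro mult_left_mono) auto
  also have "\<dots> = \<bar>of_int ?q * r\<bar>"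
    using quotient_of_denom_pos'[of r] by (simp add: abs_mult)
  also have "\<dots> = of_int \<bar>?p\<bar>"
    by (simp add: denominator_times)
  finally show ?thesis
    using p by simp
qed

text \<open>The product of all denominators works: each factor is at most 2 to the power of its encoding length.\<close>

lemma common_denominator:
  assumes "finite I"
  shows "\<exists>D :: int. 1 \<le> D \<and> D \<le> 2 ^ (\<Sum>i\<in>I. rat_bits (f i)) \<and> (\<forall>i\<in>I. of_int D * f i \<in> \<int>)"
  using assms
proof induction
  case empty
  show ?case by (intro exI[of _ 1]) simp
next
  case (insert k I)
  then obtain D :: int where D: "1 \<le> D" "D \<le> 2 ^ (\<Sum>i\<in>I. rat_bits (f i))"
    "\<forall>i\<in>I. of_int D * f i \<in> \<int>"
    by blast
  let ?q = "snd (quotient_of (f k))"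
  have q: "1 \<le> ?q"
    using quotient_of_denom_pos'[of "f k"] by linarith
  have "1 * 1 \<le> ?q * D"
    using q D(1) by (intro mult_mono) auto
  moreover have "?q * D \<le> 2 ^ rat_bits (f k) * 2 ^ (\<Sum>i\<in>I. rat_bits (f i))"
    using D denominator_le[of "f k"] by (intro mult_mono) auto
  moreover have "of_int (?q * D) * f i \<in> \<int>" if "i \<in> insert k I" for i
  proof (cases "i = k")
    case True
    have "of_int (?q * D) * f k = of_int D * (of_int ?q * f k)"
      by simp
    also have "\<dots> \<in> \<int>"
      unfolding denominator_times by simp
    finally show ?thesis
      using True by simp
  next
    case False
    then have "of_int ?q * (of_int D * f i) \<in> \<int>"
      using that D(3) Ints_mult[OF Ints_of_int[of ?q]] by blast
    then show ?thesis
      by (simp add: mult.assoc)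
  qed
  ultimately show ?case
    using insert.hyps by (intro exI[of _ "?q * D"]) (simp add: power_add)
qed

lemma vec_common_denominator:
  "\<exists>D :: int. 1 \<le> D \<and> D \<le> 2 ^ vec_bits v \<and> (\<forall>i < dim_vec v. of_int D * v $ i \<in> \<int>)"
proof -
  obtain D :: int where D: "1 \<le> D" "D \<le> 2 ^ (\<Sum>i<dim_vec v. rat_bits (v $ i))"
    "\<forall>i<dim_vec v. of_int D * v $ i \<in> \<int>"
    using common_denominator[of "{..<dim_vec v}" "\<lambda>i. v $ i"] by auto
  note D(2)
  also have "(2 :: int) ^ (\<Sum>i<dim_vec v. rat_bits (v $ i)) \<le> 2 ^ vec_bits v"
    by (intro power_increasing) (auto simp: vec_bits_def)
  finally show ?thesis
    using D by blast
qed

text \<open>A single sum over index pairs lets matrices be treated like other finite families.\<close>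

lemma mat_bits_eq:
  "mat_bits M = dim_row M * dim_col M + (\<Sum>ij\<in>{..<dim_row M} \<times> {..<dim_col M}. rat_bits (M $$ ij))"
  by (simp add: mat_bits_def sum.cartesian_product case_prod_unfold)

lemma mat_common_denominator:
  "\<exists>D :: int. 1 \<le> D \<and> D \<le> 2 ^ mat_bits M \<and>
     (\<forall>i < dim_row M. \<forall>j < dim_col M. of_int D * M $$ (i, j) \<in> \<int>)"
proof -
  obtain D :: int where D: "1 \<le> D"
    "D \<le> 2 ^ (\<Sum>ij\<in>{..<dim_row M} \<times> {..<dim_col M}. rat_bits (M $$ ij))"
    "\<forall>ij\<in>{..<dim_row M} \<times> {..<dim_col M}. of_int D * M $$ ij \<in> \<int>"
    using common_denominator[of "{..<dim_row M} \<times> {..<dim_col M}" "\<lambda>ij. M $$ ij"] by auto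
  note D(2)
  also have "(2 :: int) ^ (\<Sum>ij\<in>{..<dim_row M} \<times> {..<dim_col M}. rat_bits (M $$ ij)) \<le> 2 ^ mat_bits M"
    by (intro power_increasing) (auto simp: mat_bits_eq)
  finally show ?thesis
    using D by blast
qed

lemma rat_bits_vec_entry_le:
  assumes "i < dim_vec v"
  shows "rat_bits (v $ i) \<le> vec_bits v"
  using assms member_le_sum[of i "{..<dim_vec v}" "\<lambda>i. rat_bits (v $ i)"]
  by (simp add: vec_bits_def)

lemma rat_bits_mat_entry_le:
  assumes "i < dim_row M" "j < dim_col M"
  shows "rat_bits (M $$ (i, j)) \<le> mat_bits M"
  using assms member_le_sum[of "(i, j)" "{..<dim_row M} \<times> {..<dim_col M}" "\<lambda>ij. rat_bits (M $$ ij)"]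
  by (simp add: mat_bits_eq)

lemma input_common_denominator:
  fixes A b H c
  defines "L \<equiv> input_bits A b H c"
  shows "\<exists>D :: int. 1 \<le> D \<and> D \<le> 2 ^ L \<and>
    (\<forall>i < dim_row A. \<forall>j < dim_col A. of_int D * A $$ (i, j) \<in> \<int>) \<and>
    (\<forall>i < dim_vec b. of_int D * b $ i \<in> \<int>) \<and>
    (\<forall>i < dim_row H. \<forall>j < dim_col H. of_int D * H $$ (i, j) \<in> \<int>) \<and>
    (\<forall>i < dim_vec c. of_int D * c $ i \<in> \<int>)"
proof -
  obtain D1 where D1: "1 \<le> D1" "D1 \<le> 2 ^ mat_bits A"
    "\<And>i j. i < dim_row A \<Longrightarrow> j < dim_col A \<Longrightarrow> of_int D1 * A $$ (i, j) \<in> \<int>"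
    using mat_common_denominator[of A] by blast
  obtain D2 where D2: "1 \<le> D2" "D2 \<le> 2 ^ vec_bits b"
    "\<And>i. i < dim_vec b \<Longrightarrow> of_int D2 * b $ i \<in> \<int>"
    using vec_common_denominator[of b] by blast
  obtain D3 where D3: "1 \<le> D3" "D3 \<le> 2 ^ mat_bits H"
    "\<And>i j. i < dim_row H \<Longrightarrow> j < dim_col H \<Longrightarrow> of_int D3 * H $$ (i, j) \<in> \<int>"
    using mat_common_denominator[of H] by blast
  obtain D4 where D4: "1 \<le> D4" "D4 \<le> 2 ^ vec_bits c"
    "\<And>i. i < dim_vec c \<Longrightarrow> of_int D4 * c $ i \<in> \<int>"
    using vec_common_denominator[of c] by blast
  let ?D = "D1 * D2 * D3 * D4"
  have "1 * 1 * 1 * 1 \<le> ?D"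
    using D1(1) D2(1) D3(1) D4(1) by (intro mult_mono) auto
  moreover have "?D \<le> 2 ^ mat_bits A * 2 ^ vec_bits b * 2 ^ mat_bits H * 2 ^ vec_bits c"
    using D1(1,2) D2(1,2) D3(1,2) D4(1,2) by (intro mult_mono) auto
  moreover have "\<dots> = (2 :: int) ^ L"
    by (simp add: L_def input_bits_def power_add)
  moreover have extend: "of_int (d * e) * r \<in> \<int>" if "of_int d * r \<in> \<int>" for d e and r :: rat
    using Ints_mult[OF Ints_of_int[of e] that] by (simp add: mult_ac)
  have "of_int ?D * r \<in> \<int>" if "of_int D1 * r \<in> \<int> \<or> of_int D2 * r \<in> \<int> \<or> of_int D3 * r \<in> \<int> \<or> of_int D4 * r \<in> \<int>"
    for r :: rat
    using that extend[of D1 r "D2 * D3 * D4"] extend[of D2 r "D1 * D3 * D4"]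
      extend[of D3 r "D1 * D2 * D4"] extend[of D4 r "D1 * D2 * D3"] by (auto simp: mult_ac)
  ultimately show ?thesis
    using D1(3) D2(3) D3(3) D4(3) by (intro exI[of _ ?D]) auto
qed

section \<open>Size of basic multipliers\<close>

text \<open>The coefficients of the system that determines \<open>x\<close> and a basic multiplier \<open>l\<close>. Instead of deleting
  the rows and columns outside the support of \<open>l\<close>, the columns are cleared and the rows replaced by the equations
  \<open>u\<^sub>i = 0\<close>, which keeps the order of the system at \<open>n + m\<close> for every support.\<close>

definition kkt_matrix :: "real mat \<Rightarrow> real mat \<Rightarrow> real vec \<Rightarrow> real mat" where
  "kkt_matrix A H l =
     four_block_mat (H + transpose_mat H)
       (mat (dim_col A) (dim_row A) (\<lambda>(j, i). if l $ i = 0 then 0 else - A $$ (i, j)))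
       (mat (dim_row A) (dim_col A) (\<lambda>(i, j). if l $ i = 0 then 0 else A $$ (i, j)))
       (mat (dim_row A) (dim_row A) (\<lambda>(i, k). if i = k \<and> l $ i = 0 then 1 else 0))"

lemma kkt_matrix_carrier:
  assumes "A \<in> carrier_mat m n" "H \<in> carrier_mat n n"
  shows "kkt_matrix A H l \<in> carrier_mat (n + m) (n + m)"
  using assms unfolding kkt_matrix_def by (intro four_block_carrier_mat) auto

text \<open>On vectors \<open>u\<close> supported in the support of \<open>l\<close>, the masked copy of \<open>- A\<^sup>T\<close> acts as \<open>- A\<^sup>T\<close>, and
  the equations \<open>u\<^sub>i = 0\<close> are satisfied.\<close>

lemma kkt_matrix_mult_vec:
  assumes A: "A \<in> carrier_mat m n" and H: "H \<in> carrier_mat n n"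
    and y: "y \<in> carrier_vec n" and u: "u \<in> carrier_vec m"
    and supp: "\<And>i. i < m \<Longrightarrow> l $ i = 0 \<Longrightarrow> u $ i = 0"
  shows "kkt_matrix A H l *\<^sub>v (y @\<^sub>v u) =
    ((H + transpose_mat H) *\<^sub>v y - transpose_mat A *\<^sub>v u) @\<^sub>v
    vec m (\<lambda>i. if l $ i = 0 then 0 else (A *\<^sub>v y) $ i)"
proof -
  let ?B = "mat n m (\<lambda>(j, i). if l $ i = 0 then 0 else - A $$ (i, j))"
  let ?C = "mat m n (\<lambda>(i, j). if l $ i = 0 then 0 else A $$ (i, j))"
  let ?E = "mat m m (\<lambda>(i, k). if i = k \<and> l $ i = 0 then 1 else 0 :: real)"
  have "kkt_matrix A H l *\<^sub>v (y @\<^sub>v u) =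
      ((H + transpose_mat H) *\<^sub>v y + ?B *\<^sub>v u) @\<^sub>v (?C *\<^sub>v y + ?E *\<^sub>v u)"
    unfolding kkt_matrix_def carrier_matD[OF A]
    by (rule four_block_mat_mult_vec) (use H y u in auto)
  moreover have "?B *\<^sub>v u = - (transpose_mat A *\<^sub>v u)"
  proof (rule eq_vecI)
    fix j assume "j < dim_vec (- (transpose_mat A *\<^sub>v u))"
    then have j: "j < n"
      using A by simp
    have "(?B *\<^sub>v u) $ j = (\<Sum>i = 0..<m. (if l $ i = 0 then 0 else - A $$ (i, j)) * u $ i)"
      using j u by (simp add: scalar_prod_def)
    also have "\<dots> = (\<Sum>i = 0..<m. - (A $$ (i, j) * u $ i))"
      using supp by (intro sum.cong) auto
    also have "\<dots> = (- (transpose_mat A *\<^sub>v u)) $ j"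
      using j u A by (simp add: scalar_prod_def sum_negf)
    finally show "(?B *\<^sub>v u) $ j = (- (transpose_mat A *\<^sub>v u)) $ j" .
  qed (use A in simp)
  moreover have "?C *\<^sub>v y + ?E *\<^sub>v u = vec m (\<lambda>i. if l $ i = 0 then 0 else (A *\<^sub>v y) $ i)"
  proof (rule eq_vecI)
    fix i assume "i < dim_vec (vec m (\<lambda>i. if l $ i = 0 then 0 else (A *\<^sub>v y) $ i))"
    then have i: "i < m"
      by simp
    have "(?E *\<^sub>v u) $ i = (\<Sum>k = 0..<m. (if i = k \<and> l $ i = 0 then 1 else 0) * u $ k)"
      using i u by (simp add: scalar_prod_def)
    also have "\<dots> = (\<Sum>k = 0..<m. 0)"
      using supp i by (intro sum.cong) auto
    finally have "(?E *\<^sub>v u) $ i = 0"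
      by simp
    moreover have "(?C *\<^sub>v y) $ i = (if l $ i = 0 then 0 else (A *\<^sub>v y) $ i)"
      using i y A by (simp add: scalar_prod_def)
    ultimately show "(?C *\<^sub>v y + ?E *\<^sub>v u) $ i =
        vec m (\<lambda>i. if l $ i = 0 then 0 else (A *\<^sub>v y) $ i) $ i"
      using i by (simp del: index_mult_mat_vec)
  qed simp
  moreover have "(H + transpose_mat H) *\<^sub>v y + - (transpose_mat A *\<^sub>v u) =
      (H + transpose_mat H) *\<^sub>v y - transpose_mat A *\<^sub>v u"
    using H A by (intro eq_vecI) auto
  ultimately show ?thesis
    by simp
qed

text \<open>These rows force a kernel vector into the support of \<open>l\<close>, where \<open>kkt_matrix_mult_vec\<close> applies.\<close>

lemma kkt_matrix_unsupported_row:
  assumes A: "A \<in> carrier_mat m n" and H: "H \<in> carrier_mat n n"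
    and y: "y \<in> carrier_vec n" and u: "u \<in> carrier_vec m" and i: "i < m" and "l $ i = 0"
  shows "(kkt_matrix A H l *\<^sub>v (y @\<^sub>v u)) $ (n + i) = u $ i"
proof -
  let ?K = "kkt_matrix A H l"
  have K: "?K \<in> carrier_mat (n + m) (n + m)"
    by (rule kkt_matrix_carrier[OF A H])
  have "row ?K (n + i) = unit_vec (n + m) (n + i)"
    using A H i \<open>l $ i = 0\<close> K by (intro eq_vecI) (auto simp: kkt_matrix_def)
  then show ?thesis
    using i y u K by (simp add: scalar_prod_left_unit[of _ "n + m"])
qed

text \<open>For \<open>(y, u)\<close> in the kernel, \<open>u\<close> vanishes off the support and \<open>A y\<close> vanishes on it, so
  \<open>u \<bullet> (A y) = 0\<close>. Pairing the stationarity rows \<open>(H + H\<^sup>T) y = A\<^sup>T u\<close> with \<open>y\<close> gives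
  \<open>2 y \<bullet> (H y) = u \<bullet> (A y) = 0\<close>. Positive definiteness yields \<open>y = 0\<close>, and then \<open>A\<^sup>T u = 0\<close> forces
  \<open>u = 0\<close> because \<open>l\<close> is basic.\<close>

lemma kkt_matrix_injective:
  assumes A: "A \<in> carrier_mat m n" and pd: "positive_definite n H" and basic: "basic_multiplier A l"
    and v: "v \<in> carrier_vec (n + m)" and null: "kkt_matrix A H l *\<^sub>v v = 0\<^sub>v (n + m)"
  shows "v = 0\<^sub>v (n + m)"
proof -
  have H: "H \<in> carrier_mat n n"
    using pd by (simp add: positive_definite_def)
  define y where "y = vec_first v n"
  define u where "u = vec_last v m"
  have y: "y \<in> carrier_vec n" and u: "u \<in> carrier_vec m" and v_eq: "v = y @\<^sub>v u"
    using v by (simp_all add: y_def u_def)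
  have supp: "u $ i = 0" if "i < m" "l $ i = 0" for i
    using kkt_matrix_unsupported_row[OF A H y u that] null that(1) by (simp add: v_eq)
  have zero: "0\<^sub>v (n + m) = 0\<^sub>v n @\<^sub>v (0\<^sub>v m :: real vec)"
    by (intro eq_vecI) auto
  have stat: "(H + transpose_mat H) *\<^sub>v y - transpose_mat A *\<^sub>v u = 0\<^sub>v n"
    and act: "vec m (\<lambda>i. if l $ i = 0 then 0 else (A *\<^sub>v y) $ i) = 0\<^sub>v m"
  proof -
    have Kv: "kkt_matrix A H l *\<^sub>v v = ((H + transpose_mat H) *\<^sub>v y - transpose_mat A *\<^sub>v u) @\<^sub>v
        vec m (\<lambda>i. if l $ i = 0 then 0 else (A *\<^sub>v y) $ i)"
      unfolding v_eq by (rule kkt_matrix_mult_vec[OF A H y u]) (rule supp)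
    have "(H + transpose_mat H) *\<^sub>v y - transpose_mat A *\<^sub>v u \<in> carrier_vec n"
      using A H by (intro carrier_vecI) simp
    then show "(H + transpose_mat H) *\<^sub>v y - transpose_mat A *\<^sub>v u = 0\<^sub>v n"
      "vec m (\<lambda>i. if l $ i = 0 then 0 else (A *\<^sub>v y) $ i) = 0\<^sub>v m"
      using null append_vec_eq[of "(H + transpose_mat H) *\<^sub>v y - transpose_mat A *\<^sub>v u" n "0\<^sub>v n"]
      unfolding Kv zero by simp_all
  qed
  have Hy: "H *\<^sub>v y \<in> carrier_vec n" and Hty: "transpose_mat H *\<^sub>v y \<in> carrier_vec n"
    and Atu: "transpose_mat A *\<^sub>v u \<in> carrier_vec n" and Ht: "transpose_mat H \<in> carrier_mat n n"
    using H A y u by auto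
  have "u \<bullet> (A *\<^sub>v y) = 0"
    unfolding scalar_prod_def
  proof (rule sum.neutral, intro ballI)
    fix i assume "i \<in> {0..<dim_vec (A *\<^sub>v y)}"
    then have i: "i < m"
      using A by simp
    then have "l $ i = 0 \<or> (A *\<^sub>v y) $ i = 0"
      using arg_cong[OF act, of "\<lambda>w. w $ i"] by (simp split: if_splits)
    then show "u $ i * (A *\<^sub>v y) $ i = 0"
      using supp[OF i] by auto
  qed
  then have "((H + transpose_mat H) *\<^sub>v y - transpose_mat A *\<^sub>v u) \<bullet> y = 2 * (y \<bullet> (H *\<^sub>v y))"
    unfolding add_mult_distrib_mat_vec[OF H Ht y]
    using Hy Hty Atu y transpose_vec_mult_scalar[OF H y y] transpose_vec_mult_scalar[OF A y u]
      comm_scalar_prod[OF Hy y]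
    by (simp add: minus_scalar_prod_distrib[of _ n] add_scalar_prod_distrib[of _ n])
  then have "y \<bullet> (H *\<^sub>v y) = 0"
    unfolding stat using y by simp
  then have y0: "y = 0\<^sub>v n"
    using pd y unfolding positive_definite_def by force
  have "(H + transpose_mat H) *\<^sub>v y = 0\<^sub>v n"
    unfolding y0 using H by (intro eq_vecI) auto
  then have "- (transpose_mat A *\<^sub>v u) = 0\<^sub>v n"
    using stat Atu by simp
  then have "transpose_mat A *\<^sub>v u = 0\<^sub>v n"
    using Atu by (metis uminus_uminus_vec uminus_zero_vec)
  then have "u = 0\<^sub>v m"
    using basic u A supp unfolding basic_multiplier_def by simp
  then show ?thesis
    unfolding v_eq y0 zero by simp
qed

lemma kkt_matrix_solution:
  assumes A: "A \<in> carrier_mat m n" and b: "b \<in> carrier_vec m" and c: "c \<in> carrier_vec n"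
    and H: "H \<in> carrier_mat n n" and x: "x \<in> carrier_vec n"
    and kkt: "kkt_multiplier A b H c x l"
  shows "kkt_matrix A H l *\<^sub>v (x @\<^sub>v l) = (- c) @\<^sub>v vec m (\<lambda>i. if l $ i = 0 then 0 else b $ i)"
proof -
  have l: "l \<in> carrier_vec m" and G: "gradient H c x = transpose_mat A *\<^sub>v l"
    and slack: "\<And>i. i < m \<Longrightarrow> l $ i = 0 \<or> (A *\<^sub>v x) $ i = b $ i"
    using kkt A by (auto simp: kkt_multiplier_def dual_feasible_set_def)
  have "(H + transpose_mat H) *\<^sub>v x - transpose_mat A *\<^sub>v l = - c"
    unfolding G[symmetric] gradient_def using H c by (intro eq_vecI) auto
  moreover have "vec m (\<lambda>i. if l $ i = 0 then 0 else (A *\<^sub>v x) $ i) =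
      vec m (\<lambda>i. if l $ i = 0 then 0 else b $ i)"
    using slack by (intro eq_vecI) (auto simp del: index_mult_mat_vec)
  ultimately show ?thesis
    by (simp add: kkt_matrix_mult_vec[OF A H x l])
qed

text \<open>The number \<open>D\<close> is a common denominator of the data. The scaled system has entries of absolute
  value at most \<open>2 B\<close>; the factor 2 comes from \<open>H + H\<^sup>T\<close>. The hypothesis \<open>D \<le> B\<close> covers the unit rows,
  which become multiples of \<open>D\<close>.\<close>

lemma basic_kkt_multiplier_bound:
  assumes A: "A \<in> carrier_mat m n" and b: "b \<in> carrier_vec m" and c: "c \<in> carrier_vec n"
    and pd: "positive_definite n H" and x: "x \<in> carrier_vec n"
    and kkt: "kkt_multiplier A b H c x l" and basic: "basic_multiplier A l"
    and D: "D \<in> \<int>" "1 \<le> D" "D \<le> B"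
    and A_int: "\<And>i j. i < m \<Longrightarrow> j < n \<Longrightarrow> D * A $$ (i, j) \<in> \<int> \<and> \<bar>D * A $$ (i, j)\<bar> \<le> B"
    and b_int: "\<And>i. i < m \<Longrightarrow> D * b $ i \<in> \<int> \<and> \<bar>D * b $ i\<bar> \<le> B"
    and H_int: "\<And>i j. i < n \<Longrightarrow> j < n \<Longrightarrow> D * H $$ (i, j) \<in> \<int> \<and> \<bar>D * H $$ (i, j)\<bar> \<le> B"
    and c_int: "\<And>i. i < n \<Longrightarrow> D * c $ i \<in> \<int> \<and> \<bar>D * c $ i\<bar> \<le> B"
    and i: "i < m"
  shows "\<bar>l $ i\<bar> \<le> fact (n + m) * (2 * B) ^ (n + m)"
proof -
  have H: "H \<in> carrier_mat n n"
    using pd by (simp add: positive_definite_def)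
  have l: "l \<in> carrier_vec m"
    using kkt A by (simp add: kkt_multiplier_def dual_feasible_set_def)
  have B: "1 \<le> B"
    using D by simp
  let ?K = "kkt_matrix A H l"
  have K: "?K \<in> carrier_mat (n + m) (n + m)"
    by (rule kkt_matrix_carrier[OF A H])
  have scale: "(D \<cdot>\<^sub>m ?K) *\<^sub>v v = D \<cdot>\<^sub>v (?K *\<^sub>v v)" if "v \<in> carrier_vec (n + m)" for v
    using K that by (intro eq_vecI) auto
  have xl: "x @\<^sub>v l \<in> carrier_vec (n + m)"
    using x l by simp
  have "\<bar>(x @\<^sub>v l) $ (n + i)\<bar> \<le> fact (n + m) * (2 * B) ^ (n + m)"
  proof (rule integer_system_solution_bound)
    show "D \<cdot>\<^sub>m ?K \<in> carrier_mat (n + m) (n + m)" "x @\<^sub>v l \<in> carrier_vec (n + m)" "n + i < n + m"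
      using K xl i by auto
  next
    fix v assume v: "v \<in> carrier_vec (n + m)" and "(D \<cdot>\<^sub>m ?K) *\<^sub>v v = 0\<^sub>v (n + m)"
    then have Kv: "D \<cdot>\<^sub>v (?K *\<^sub>v v) = 0\<^sub>v (n + m)"
      by (simp add: scale)
    have "?K *\<^sub>v v = 0\<^sub>v (n + m)"
    proof (rule eq_vecI)
      fix k assume "k < dim_vec (0\<^sub>v (n + m) :: real vec)"
      then show "(?K *\<^sub>v v) $ k = 0\<^sub>v (n + m) $ k"
        using arg_cong[OF Kv, of "\<lambda>w. w $ k"] K D(2) by (simp del: index_mult_mat_vec)
    qed (use K in simp)
    then show "v = 0\<^sub>v (n + m)"
      by (rule kkt_matrix_injective[OF A pd basic v])
  next
    fix r s assume rs: "r < n + m" "s < n + m"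
    have neg: "D * - A $$ (k, j) \<in> \<int> \<and> \<bar>D * - A $$ (k, j)\<bar> \<le> 2 * B"
      "D * A $$ (k, j) \<in> \<int> \<and> \<bar>D * A $$ (k, j)\<bar> \<le> 2 * B" if "k < m" "j < n" for k j
      using A_int[OF that] B by auto
    have sym: "D * (H $$ (k, j) + H $$ (j, k)) \<in> \<int> \<and> \<bar>D * (H $$ (k, j) + H $$ (j, k))\<bar> \<le> 2 * B"
      if "k < n" "j < n" for k j
      unfolding distrib_left using H_int[of k j] H_int[of j k] that by auto
    have "(D \<cdot>\<^sub>m ?K) $$ (r, s) = D * ?K $$ (r, s)"
      using K rs by simp
    also have "?K $$ (r, s) =
       (if r < n then if s < n then H $$ (r, s) + H $$ (s, r)
          else if l $ (s - n) = 0 then 0 else - A $$ (s - n, r)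
        else if s < n then if l $ (r - n) = 0 then 0 else A $$ (r - n, s)
          else if r = s \<and> l $ (r - n) = 0 then 1 else 0)"
      using A H rs by (auto simp: kkt_matrix_def)
    finally show "(D \<cdot>\<^sub>m ?K) $$ (r, s) \<in> \<int> \<and> \<bar>(D \<cdot>\<^sub>m ?K) $$ (r, s)\<bar> \<le> 2 * B"
      using neg[of "s - n" r] neg[of "r - n" s] sym[of r s] D B rs by (auto split: if_splits)
  next
    fix r assume r: "r < n + m"
    have "((D \<cdot>\<^sub>m ?K) *\<^sub>v (x @\<^sub>v l)) $ r =
        D * ((- c) @\<^sub>v vec m (\<lambda>i. if l $ i = 0 then 0 else b $ i)) $ r"
      unfolding scale[OF xl] kkt_matrix_solution[OF A b c H x kkt] using r c by simp
    also have "\<dots> = (if r < n then - (D * c $ r) else if l $ (r - n) = 0 then 0 else D * b $ (r - n))"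
      using r c by auto
    finally have "((D \<cdot>\<^sub>m ?K) *\<^sub>v (x @\<^sub>v l)) $ r =
        (if r < n then - (D * c $ r) else if l $ (r - n) = 0 then 0 else D * b $ (r - n))" .
    moreover have "r - n < m" if "\<not> r < n"
      using that r by simp
    ultimately show "((D \<cdot>\<^sub>m ?K) *\<^sub>v (x @\<^sub>v l)) $ r \<in> \<int> \<and>
        \<bar>((D \<cdot>\<^sub>m ?K) *\<^sub>v (x @\<^sub>v l)) $ r\<bar> \<le> 2 * B"
      using c_int[of r] b_int[of "r - n"] B by auto
  qed
  then show ?thesis
    using x l i by simp
qed

text \<open>The arithmetic behind the exponent: \<open>L\<close> bounds the order of the system and the number of
  entries of \<open>l\<close>, and \<open>L! \<le> L\<^sup>L \<le> 2\<^bsup>L * L\<^esup>\<close>.\<close>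

lemma norm1_vec_le_pow2:
  fixes l :: "real vec"
  assumes l: "l \<in> carrier_vec m" and N: "n + m \<le> L"
    and entry: "\<And>i. i < m \<Longrightarrow> \<bar>l $ i\<bar> \<le> fact (n + m) * (2 * (2 ^ L * 2 ^ L)) ^ (n + m)"
  shows "norm1_vec l \<le> 2 ^ (3 * L\<^sup>2 + 2 * L)"
proof -
  have L_le: "real L \<le> 2 ^ L"
    by (simp add: less_imp_le)
  have m_le: "real m \<le> 2 ^ L"
    using N L_le by linarith
  have "fact (n + m) \<le> real (fact L)"
    using fact_mono[OF N] by (metis of_nat_fact of_nat_mono)
  also have "\<dots> \<le> real L ^ L"
    using fact_le_power[of L, where 'a = real] by simp
  also have "\<dots> \<le> (2 ^ L) ^ L"
    by (rule power_mono[OF L_le]) simp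
  finally have fact_le: "(fact (n + m) :: real) \<le> (2 ^ L) ^ L"
    by simp
  have pow_le: "(2 * (2 ^ L * 2 ^ L)) ^ (n + m) \<le> (2 * (2 ^ L * 2 ^ L) :: real) ^ L"
    by (rule power_increasing[OF N]) (metis mult_2 one_le_numeral one_le_power power_Suc power_add)
  have "norm1_vec l = (\<Sum>i<m. \<bar>l $ i\<bar>)"
    using l by (simp add: norm1_vec_def)
  also have "\<dots> \<le> (\<Sum>i<m. (2 ^ L) ^ L * (2 * (2 ^ L * 2 ^ L)) ^ L)"
  proof (rule sum_mono)
    fix i assume "i \<in> {..<m}"
    then have "\<bar>l $ i\<bar> \<le> fact (n + m) * (2 * (2 ^ L * 2 ^ L)) ^ (n + m)"
      using entry by simp
    also have "\<dots> \<le> (2 ^ L) ^ L * (2 * (2 ^ L * 2 ^ L)) ^ L"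
      using fact_le pow_le by (intro mult_mono) auto
    finally show "\<bar>l $ i\<bar> \<le> (2 ^ L) ^ L * (2 * (2 ^ L * 2 ^ L)) ^ L" .
  qed
  also have "\<dots> = real m * ((2 ^ L) ^ L * (2 * (2 ^ L * 2 ^ L)) ^ L)"
    by simp
  also have "\<dots> \<le> 2 ^ L * ((2 ^ L) ^ L * (2 * (2 ^ L * 2 ^ L)) ^ L)"
    using m_le by (intro mult_right_mono) auto
  also have "\<dots> = 2 ^ (L + (L * L + (1 + (L + L)) * L))"
    by (simp only: power_mult power_add power_one_right)
  also have "L + (L * L + (1 + (L + L)) * L) = 3 * L\<^sup>2 + 2 * L"
    by (simp add: power2_eq_square algebra_simps)
  finally show ?thesis .
qed

lemma scaled_rat_entry:
  assumes D: "1 \<le> D" "D \<le> 2 ^ L" and int: "of_int D * r \<in> (\<int> :: rat set)" and r: "rat_bits r \<le> L"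
  shows "of_int D * real_of_rat r \<in> \<int> \<and> \<bar>of_int D * real_of_rat r\<bar> \<le> 2 ^ L * 2 ^ L"
proof
  obtain k where "of_int D * r = of_int k"
    using int by (auto elim: Ints_cases)
  then have "of_int D * real_of_rat r = of_int k"
    by (metis of_rat_mult of_rat_of_int_eq)
  then show "of_int D * real_of_rat r \<in> \<int>"
    by simp
  have "real_of_rat \<bar>r\<bar> \<le> real_of_rat (2 ^ rat_bits r)"
    using abs_rat_le[of r] by (simp only: of_rat_less_eq)
  also have "\<dots> = 2 ^ rat_bits r"
    by (simp add: of_rat_power)
  also have "\<dots> \<le> (2 :: real) ^ L"
    using r by (rule power_increasing) simp
  finally have "\<bar>real_of_rat r\<bar> \<le> 2 ^ L"
    by simp
  moreover have "real_of_int D \<le> 2 ^ L"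
    using D(2) by (metis of_int_le_iff of_int_numeral of_int_power)
  ultimately show "\<bar>of_int D * real_of_rat r\<bar> \<le> 2 ^ L * 2 ^ L"
    using D(1) unfolding abs_mult by (intro mult_mono) auto
qed

lemma rat_kkt_multiplier_norm_bound:
  assumes A: "A \<in> carrier_mat m n" and b: "b \<in> carrier_vec m" and H: "H \<in> carrier_mat n n"
    and c: "c \<in> carrier_vec n" and pd: "positive_definite n (real_mat H)" and x: "x \<in> carrier_vec n"
    and kkt: "kkt_multiplier (real_mat A) (real_vec b) (real_mat H) (real_vec c) x l"
    and basic: "basic_multiplier (real_mat A) l"
  shows "norm1_vec l \<le> 2 ^ (3 * (input_bits A b H c)\<^sup>2 + 2 * input_bits A b H c)"
proof (rule norm1_vec_le_pow2)
  let ?L = "input_bits A b H c"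
  show "l \<in> carrier_vec m"
    using kkt A by (simp add: kkt_multiplier_def dual_feasible_set_def)
  have "n + m \<le> n * n + m"
    by simp
  also have "\<dots> \<le> ?L"
    using b H by (simp add: input_bits_def mat_bits_def vec_bits_def)
  finally show "n + m \<le> ?L" .
  obtain D where D: "1 \<le> D" "D \<le> 2 ^ ?L"
    and D_A: "\<And>i j. i < m \<Longrightarrow> j < n \<Longrightarrow> of_int D * A $$ (i, j) \<in> \<int>"
    and D_b: "\<And>i. i < m \<Longrightarrow> of_int D * b $ i \<in> \<int>"
    and D_H: "\<And>i j. i < n \<Longrightarrow> j < n \<Longrightarrow> of_int D * H $$ (i, j) \<in> \<int>"
    and D_c: "\<And>i. i < n \<Longrightarrow> of_int D * c $ i \<in> \<int>"
    using input_common_denominator[of A b H c] carrier_matD[OF A] carrier_vecD[OF b]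
      carrier_matD[OF H] carrier_vecD[OF c] by metis
  have entries: "mat_bits A \<le> ?L" "vec_bits b \<le> ?L" "mat_bits H \<le> ?L" "vec_bits c \<le> ?L"
    by (simp_all add: input_bits_def)
  have "real_of_int D \<le> 2 ^ ?L"
    using D(2) by (metis of_int_le_iff of_int_numeral of_int_power)
  also have "\<dots> \<le> 2 ^ ?L * 2 ^ ?L"
    by simp
  finally have D_le: "real_of_int D \<le> 2 ^ ?L * 2 ^ ?L" .
  fix i assume "i < m"
  then show "\<bar>l $ i\<bar> \<le> fact (n + m) * (2 * (2 ^ ?L * 2 ^ ?L)) ^ (n + m)"
  proof (rule basic_kkt_multiplier_bound[OF _ _ _ pd x kkt basic _ _ D_le, rotated -1])
    show "real_mat A \<in> carrier_mat m n" "real_vec b \<in> carrier_vec m" "real_vec c \<in> carrier_vec n"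
      "real_of_int D \<in> \<int>" "1 \<le> real_of_int D"
      using A b c D by auto
  next
    fix i j assume "i < m" "j < n"
    then show "of_int D * real_mat A $$ (i, j) \<in> \<int> \<and> \<bar>of_int D * real_mat A $$ (i, j)\<bar> \<le> 2 ^ ?L * 2 ^ ?L"
      using scaled_rat_entry[OF D D_A] rat_bits_mat_entry_le[of i A j] entries A by simp
  next
    fix i assume "i < m"
    then show "of_int D * real_vec b $ i \<in> \<int> \<and> \<bar>of_int D * real_vec b $ i\<bar> \<le> 2 ^ ?L * 2 ^ ?L"
      using scaled_rat_entry[OF D D_b] rat_bits_vec_entry_le[of i b] entries b by simp
  next
    fix i j assume "i < n" "j < n"
    then show "of_int D * real_mat H $$ (i, j) \<in> \<int> \<and> \<bar>of_int D * real_mat H $$ (i, j)\<bar> \<le> 2 ^ ?L * 2 ^ ?L"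
      using scaled_rat_entry[OF D D_H] rat_bits_mat_entry_le[of i H j] entries H by simp
  next
    fix i assume "i < n"
    then show "of_int D * real_vec c $ i \<in> \<int> \<and> \<bar>of_int D * real_vec c $ i\<bar> \<le> 2 ^ ?L * 2 ^ ?L"
      using scaled_rat_entry[OF D D_c] rat_bits_vec_entry_le[of i c] entries c by simp
  qed
qed

lemma rat_bits_pow2: "rat_bits (2 ^ k) = k + 3"
proof -
  have "quotient_of (2 ^ k) = (2 ^ k, 1)"
    using quotient_of_int[of "2 ^ k"] by (simp add: Rat.of_int_def)
  moreover have "bitlen (2 ^ k) = 1 + int k"
    using bitlen_pow2[of 1 k] by (simp add: bitlen_alt_def)
  moreover have "bitlen 1 = 1"
    by (simp add: bitlen_alt_def)
  ultimately show ?thesis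
    by (simp add: rat_bits_def)
qed

theorem proposition7:
  shows "\<exists>(g :: rat mat \<Rightarrow> rat vec \<Rightarrow> rat mat \<Rightarrow> rat vec \<Rightarrow> rat) (p :: nat poly).
    \<forall>(n :: nat) (m :: nat) (A :: rat mat) (b :: rat vec) (H :: rat mat) (c :: rat vec) (xbar :: rat vec).
      A \<in> carrier_mat m n \<longrightarrow> b \<in> carrier_vec m \<longrightarrow>
      H \<in> carrier_mat n n \<longrightarrow> c \<in> carrier_vec n \<longrightarrow>
      positive_definite n (real_mat H) \<longrightarrow>
      xbar \<in> carrier_vec n \<longrightarrow>
      primal_optimal (real_mat A) (real_vec b) (real_mat H) (real_vec c) (real_vec xbar) \<longrightarrow>
        (\<forall>(xt :: rat vec) (\<epsilon> :: real) (l :: real vec).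
           xt \<in> carrier_vec n \<longrightarrow>
           eps_feasible (real_mat A) (real_vec b) \<epsilon> (real_vec xt) \<longrightarrow>
           dual_optimal (real_mat A) (real_vec b) (real_mat H) (real_vec c) l \<longrightarrow>
           quad_obj (real_mat H) (real_vec c) (real_vec xt)
             \<ge> quad_obj (real_mat H) (real_vec c) (real_vec xbar) - norm1_vec l * \<epsilon>)
        \<and> (\<exists>l. dual_optimal (real_mat A) (real_vec b) (real_mat H) (real_vec c) l
               \<and> norm1_vec l \<le> real_of_rat (g A b H c))
        \<and> rat_bits (g A b H c) \<le> poly p (input_bits A b H c)"
proof (rule exI[of _ "\<lambda>A b H c. 2 ^ (3 * (input_bits A b H c)\<^sup>2 + 2 * input_bits A b H c)"],
    rule exI[of _ "[:3, 2, 3:]"], intro allI impI conjI)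
  fix n m :: nat and A :: "rat mat" and b :: "rat vec" and H :: "rat mat" and c xbar :: "rat vec"
  assume carrier: "A \<in> carrier_mat m n" "b \<in> carrier_vec m" "H \<in> carrier_mat n n" "c \<in> carrier_vec n"
    and pd: "positive_definite n (real_mat H)" and xbar: "xbar \<in> carrier_vec n"
    and opt: "primal_optimal (real_mat A) (real_vec b) (real_mat H) (real_vec c) (real_vec xbar)"
  have real_carrier: "real_mat A \<in> carrier_mat m n" "real_vec b \<in> carrier_vec m"
    "real_mat H \<in> carrier_mat n n" "real_vec c \<in> carrier_vec n" "real_vec xbar \<in> carrier_vec n"
    using carrier xbar by auto
  let ?L = "input_bits A b H c"
  {
    fix xt :: "rat vec" and \<epsilon> :: real and l :: "real vec"
    assume "eps_feasible (real_mat A) (real_vec b) \<epsilon> (real_vec xt)"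
      "dual_optimal (real_mat A) (real_vec b) (real_mat H) (real_vec c) l"
    then show "quad_obj (real_mat H) (real_vec c) (real_vec xbar) - norm1_vec l * \<epsilon>
        \<le> quad_obj (real_mat H) (real_vec c) (real_vec xt)"
      using dual_optimal_sensitivity[OF real_carrier(1,2,4) pd opt] by blast
  }
  obtain l where l: "kkt_multiplier (real_mat A) (real_vec b) (real_mat H) (real_vec c) (real_vec xbar) l"
    "basic_multiplier (real_mat A) l"
    using primal_optimal_imp_basic_kkt_multiplier[OF real_carrier(1,3,4) opt] by blast
  have "dual_optimal (real_mat A) (real_vec b) (real_mat H) (real_vec c) l"
    using kkt_multiplier_dual_optimal[OF real_carrier(1,2,4) pd _ l(1)] opt
    by (simp add: primal_optimal_def)
  moreover have "norm1_vec l \<le> real_of_rat (2 ^ (3 * ?L\<^sup>2 + 2 * ?L))"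
    using rat_kkt_multiplier_norm_bound[OF carrier pd real_carrier(5) l] by (simp add: of_rat_power)
  ultimately show "\<exists>l. dual_optimal (real_mat A) (real_vec b) (real_mat H) (real_vec c) l \<and>
      norm1_vec l \<le> real_of_rat (2 ^ (3 * ?L\<^sup>2 + 2 * ?L))"
    by blast
  show "rat_bits (2 ^ (3 * ?L\<^sup>2 + 2 * ?L)) \<le> poly [:3, 2, 3:] ?L"
    by (simp add: rat_bits_pow2 power2_eq_square algebra_simps)
qed

end
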